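(* Let $\epsilon\in(0,1]$ with $1/\epsilon$ an integer, and let $n\ge1$, $k\ge 1$ be integers. Consider uniform mixtures $\mathcal{M}=\frac1k\sum_{i=1}^k\mathrm{Geo}(p_i)$ with distinct $p_1,\dots,p_k\in\big\{\frac{1}{1+n\epsilon},\frac{1}{1+(n-1)\epsilon},\dots,\frac1{1+\epsilon},1\big\}$. Then: (i) The first $4\sqrt n$ moments determine the parameters: if $X\sim\frac1k\sum_{i=1}^k\mathrm{Geo}(p_i)$ and $Y\sim\frac1k\sum_{i=1}^k\mathrm{Geo}(q_i)$ are two such mixtures and $\mathbb{E}X^\ell=\mathbb{E}Y^\ell$ for all integers $0\le\ell\le4\sqrt n$, then $\{p_1,\dots,p_k\}=\{q_1,\dots,q_k\}$. (ii) For every $\delta\in(0,1)$ there is a constant $C=C(\delta)>0$, not depending on $k,n,\epsilon$, such that for every integer $m\ge C\,k^2\big(\frac{\sqrt n}{\epsilon}\big)^{8\sqrt n}$ there is an algorithm (an estimator depending only on $k,n,\epsilon,m$) which, for every such mixture $\mathcal{M}$, given $m$ independent samples from $\mathcal{M}$ outputs exactly the set $\{p_1,\dots,p_k\}$ with probability at least $1-\delta$.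
   Context: $\mathrm{Geo}(p)$ is the geometric distribution with $\Pr(X=x)=(1-p)^xp$ for $x\in\{0,1,2,\dots\}$; $\mathrm{Geo}(1)$ is the point mass at $0$. The mixture $\frac1k\sum_i f_i$ is the distribution whose pmf is the average of the pmfs of its components. *)

theory Defs
  imports "HOL-Probability.Probability" "HOL-Real_Asymp.Real_Asymp"
begin

definition geo_mixture :: "nat \<Rightarrow> (nat \<Rightarrow> real) \<Rightarrow> nat pmf" where
  "geo_mixture k p = bind_pmf (pmf_of_set {1..k}) (\<lambda>i. geometric_pmf (p i))"

definition geo_params :: "nat \<Rightarrow> nat \<Rightarrow> real \<Rightarrow> (nat \<Rightarrow> real) \<Rightarrow> bool" where
  "geo_params k n \<epsilon> p \<longleftrightarrow>
     inj_on p {1..k} \<and> p ` {1..k} \<subseteq> (\<lambda>j. 1 / (1 + real j * \<epsilon>)) ` {0..n}"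

lemma geo_params_bounds:
  assumes "0 < \<epsilon>" "geo_params k n \<epsilon> p" "i \<in> {1..k}"
  shows "0 < p i" "p i \<le> 1"
proof -
  obtain j where "p i = 1 / (1 + real j * \<epsilon>)"
    using assms unfolding geo_params_def by blast
  moreover have "0 \<le> real j * \<epsilon>"
    using assms(1) by simp
  ultimately show "0 < p i" "p i \<le> 1"
    by simp_all
qed

lemma pmf_geo_mixture:
  assumes "1 \<le> k" "\<And>i. i \<in> {1..k} \<Longrightarrow> 0 < p i \<and> p i \<le> 1"
  shows "pmf (geo_mixture k p) x = 1 / real k * (\<Sum>i=1..k. (1 - p i) ^ x * p i)"
proof -
  have "pmf (geo_mixture k p) x = (\<Sum>i=1..k. pmf (geometric_pmf (p i)) x) / real k"
    using assms(1) by (simp add: geo_mixture_def pmf_bind_pmf_of_set)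
  also have "(\<Sum>i=1..k. pmf (geometric_pmf (p i)) x) = (\<Sum>i=1..k. (1 - p i) ^ x * p i)"
    using assms(2) by (intro sum.cong) auto
  finally show ?thesis by simp
qed

text \<open>All moments exist, so the Bochner integrals in the moment condition carry no default value.\<close>

lemma summable_geometric_moment:
  fixes r :: real
  assumes "0 \<le> r" "r < 1"
  shows "summable (\<lambda>x. real x ^ l * r ^ x)"
proof (cases "r = 0")
  case True
  show ?thesis
    by (rule summable_finite[of "{0}"]) (auto simp: True)
next
  case False
  with assms have "0 < r" by simp
  show ?thesis
  proof (rule summable_comparison_test_bigo)
    show "summable (\<lambda>x. norm (1 / real x ^ 2))"
      using inverse_power_summable[of 2, where 'a = real] by (simp add: field_simps)
    show "(\<lambda>x. real x ^ l * r ^ x) \<in> O(\<lambda>x. 1 / real x ^ 2)"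
      using \<open>0 < r\<close> \<open>r < 1\<close> by real_asymp
  qed
qed

lemma integrable_geo_mixture_moment:
  assumes "1 \<le> k" "\<And>i. i \<in> {1..k} \<Longrightarrow> 0 < p i \<and> p i \<le> 1"
  shows "integrable (geo_mixture k p) (\<lambda>x. real x ^ l)"
proof -
  have "summable (\<lambda>x. 1 / real k * (\<Sum>i=1..k. p i * (real x ^ l * (1 - p i) ^ x)))"
    using assms(2) by (intro summable_mult summable_sum summable_geometric_moment) auto
  also have "(\<lambda>x. 1 / real k * (\<Sum>i=1..k. p i * (real x ^ l * (1 - p i) ^ x))) =
      (\<lambda>x. pmf (geo_mixture k p) x * real x ^ l)"
    using pmf_geo_mixture[of k p, OF assms]
    by (simp add: fun_eq_iff sum_distrib_left sum_distrib_right mult_ac)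
  finally have "integrable (count_space UNIV) (\<lambda>x. pmf (geo_mixture k p) x * real x ^ l)"
    by (simp add: integrable_count_space_nat_iff abs_mult)
  then show ?thesis
    by (simp add: measure_pmf_eq_density integrable_density)
qed

end

theory Submission
  imports Defs "HOL-Computational_Algebra.Polynomial"
begin

text \<open>
  If \<open>X\<close> has distribution \<open>Geo(1 / (1 + j\<epsilon>))\<close>, then \<open>X choose l\<close> has mean \<open>(j\<epsilon>)\<^sup>l\<close>.  The first
  \<open>L\<close> moments of a mixture therefore determine the power sums of order at most \<open>L\<close> of the set
  \<open>J \<subseteq> {0..n}\<close> of indices occurring in it.  Two sets \<open>A \<noteq> B\<close> are told apart by a polynomial that
  at the least element \<open>j\<^sub>0\<close> of their symmetric difference exceeds the sum of its absolute values
  over \<open>j\<^sub>0 < j \<le> n\<close>.  The fourth power of the Dirichlet kernel \<open>sin((2m+1)\<phi>) / sin \<phi>\<close> with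
  \<open>m = \<lfloor>\<surd>n\<rfloor>\<close>, as a polynomial in \<open>sin\<^sup>2\<phi> = (j - j\<^sub>0)/n\<close>, has this property: its degree is
  \<open>4m \<le> 4\<surd>n\<close>, it is \<open>(2m+1)\<^sup>4 \<ge> 9n\<^sup>2\<close> at \<open>j\<^sub>0\<close>, and its remaining values sum to at most
  \<open>n\<^sup>2 \<Sum> 1/i\<^sup>2 \<le> 2n\<^sup>2\<close>.

  Its coefficients are at most exponential in \<open>\<surd>n\<close>, so the separation is quantitative: it suffices
  to know the means of \<open>X choose l\<close>, \<open>l \<le> 4m\<close>, up to \<open>(n\<epsilon>)\<^sup>l / k\<close> times a factor exponential in
  \<open>-\<surd>n\<close>.  By Chebyshev's inequality the empirical means are that accurate once the sample size
  exceeds \<open>k\<^sup>2 (c/\<epsilon>)\<^bsup>8\<surd>n\<^esup>\<close>, and exponential factors in \<open>\<surd>n\<close> are absorbed by \<open>(\<surd>n)\<^bsup>8\<surd>n\<^esup>\<close>.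
\<close>

subsection \<open>A peaking polynomial and separation by power sums\<close>

text \<open>
  In the variable \<open>c + s\<close> with \<open>s = sin\<^sup>2\<phi>\<close> this is the Dirichlet kernel \<open>sin((2m+1)\<phi>) / sin \<phi>\<close>;
  the shift \<open>c\<close> allows its peak to be moved to an arbitrary point.
\<close>

fun dirichlet_poly :: "real \<Rightarrow> nat \<Rightarrow> real poly" where
  "dirichlet_poly c 0 = 1"
| "dirichlet_poly c (Suc 0) = [:3 + 4 * c, -4:]"
| "dirichlet_poly c (Suc (Suc m)) = [:2 + 4 * c, -4:] * dirichlet_poly c (Suc m) - dirichlet_poly c m"

text \<open>The recursion is the identity \<open>sin (a + 2\<phi>) + sin (a - 2\<phi>) = 2 * cos
  (2\<phi>) * sin a\<close> together with \<open>cos (2\<phi>) = 1 - 2 * sin \<phi> ^ 2\<close>.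
  Keeping the factor \<open>sin \<phi>\<close> on the left avoids dividing by zero.\<close>

lemma sin_odd_multiple_dirichlet_poly:
  "sin \<phi> * poly (dirichlet_poly c m) (c + (sin \<phi>)\<^sup>2) = sin (real (2 * m + 1) * \<phi>)"
proof (induction c m rule: dirichlet_poly.induct)
  case (1 c)
  then show ?case by simp
next
  case (2 c)
  have "sin (3 * \<phi>) = sin (2 * \<phi> + \<phi>)" by (simp add: algebra_simps)
  also have "\<dots> = 2 * sin \<phi> * (cos \<phi>)\<^sup>2 + (1 - 2 * (sin \<phi>)\<^sup>2) * sin \<phi>"
    unfolding sin_add[of "2 * \<phi>" \<phi>] sin_double cos_double_sin by (simp add: power2_eq_square)
  also have "\<dots> = sin \<phi> * (3 - 4 * (sin \<phi>)\<^sup>2)"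
    unfolding cos_squared_eq by (simp add: algebra_simps)
  finally show ?case by (simp add: algebra_simps)
next
  case (3 c m)
  define a where "a = real (2 * m + 3) * \<phi>"
  have "sin (a + 2 * \<phi>) + sin (a - 2 * \<phi>) = 2 * cos (2 * \<phi>) * sin a"
    by (simp add: sin_add sin_diff)
  moreover have "cos (2 * \<phi>) = 1 - 2 * (sin \<phi>)\<^sup>2" by (rule cos_double_sin)
  ultimately have "sin (a + 2 * \<phi>) = (2 - 4 * (sin \<phi>)\<^sup>2) * sin a - sin (a - 2 * \<phi>)"
    by simp
  moreover have "sin \<phi> * poly (dirichlet_poly c (Suc m)) (c + (sin \<phi>)\<^sup>2) = sin a"
    using 3(1) by (simp add: a_def algebra_simps)
  moreover have "sin \<phi> * poly (dirichlet_poly c m) (c + (sin \<phi>)\<^sup>2) = sin (a - 2 * \<phi>)"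
    using 3(2) by (simp add: a_def algebra_simps)
  moreover have "a + 2 * \<phi> = real (2 * Suc (Suc m) + 1) * \<phi>"
    by (simp add: a_def algebra_simps)
  moreover have "sin \<phi> * poly (dirichlet_poly c (Suc (Suc m))) (c + (sin \<phi>)\<^sup>2) =
      (2 - 4 * (sin \<phi>)\<^sup>2) * (sin \<phi> * poly (dirichlet_poly c (Suc m)) (c + (sin \<phi>)\<^sup>2)) -
      sin \<phi> * poly (dirichlet_poly c m) (c + (sin \<phi>)\<^sup>2)"
    by (simp add: algebra_simps)
  ultimately show ?case
    by simp
qed

text \<open>The sine identity is vacuous at \<open>sin \<phi> = 0\<close>, so the peak is read off
  the recursion: at \<open>c\<close> it becomes \<open>a (m + 2) = 2 * a (m + 1) - a m\<close>,
  whose solution from 1, 3 is arithmetic.\<close>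

lemma poly_dirichlet_poly_peak: "poly (dirichlet_poly c m) c = 2 * real m + 1"
  by (induction c m rule: dirichlet_poly.induct) (auto simp: algebra_simps)

text \<open>Substituting \<open>s = sin \<phi> ^ 2\<close> turns the left-hand side into a squared
  sine.\<close>

lemma poly_dirichlet_poly_decay:
  assumes "0 \<le> s" "s \<le> 1"
  shows "s * (poly (dirichlet_poly c m) (c + s))\<^sup>2 \<le> 1"
proof -
  define \<phi> where "\<phi> = arcsin (sqrt s)"
  have "sin \<phi> = sqrt s"
    using assms by (simp add: \<phi>_def order_trans[of _ 0])
  then have s: "s = (sin \<phi>)\<^sup>2" using assms by simp
  have "s * (poly (dirichlet_poly c m) (c + s))\<^sup>2 = (sin (real (2 * m + 1) * \<phi>))\<^sup>2"
    unfolding sin_odd_multiple_dirichlet_poly[of \<phi> c m, symmetric] s by (simp add: power_mult_distrib)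
  also have "\<dots> \<le> 1"
    by (simp add: abs_square_le_1)
  finally show ?thesis .
qed

section \<open>The l1 norm of the coefficients of a polynomial\<close>

definition coeff_norm :: "real poly \<Rightarrow> real" where
  "coeff_norm q = (\<Sum>i\<le>degree q. \<bar>coeff q i\<bar>)"

lemma coeff_norm_altdef: "degree q \<le> N \<Longrightarrow> coeff_norm q = (\<Sum>i\<le>N. \<bar>coeff q i\<bar>)"
  unfolding coeff_norm_def by (rule sum.mono_neutral_left) (auto simp: coeff_eq_0)

lemma coeff_norm_nonneg: "0 \<le> coeff_norm q"
  by (simp add: coeff_norm_def sum_nonneg)

lemma coeff_norm_add: "coeff_norm (p + q) \<le> coeff_norm p + coeff_norm q"
proof -
  define N where "N = max (degree p) (degree q)"
  have "degree p \<le> N" "degree q \<le> N" "degree (p + q) \<le> N"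
    by (auto simp: N_def degree_add_le_max)
  then show ?thesis
    by (simp add: coeff_norm_altdef[of _ N] flip: sum.distrib) (intro sum_mono abs_triangle_ineq)
qed

lemma coeff_norm_uminus: "coeff_norm (- p) = coeff_norm p"
  by (simp add: coeff_norm_def)

lemma coeff_norm_smult: "coeff_norm (smult a p) = \<bar>a\<bar> * coeff_norm p"
  by (simp add: coeff_norm_altdef[of _ "degree p"] degree_smult_le abs_mult sum_distrib_left)

lemma coeff_norm_pCons: "coeff_norm (pCons a p) = \<bar>a\<bar> + coeff_norm p"
proof -
  have "coeff_norm (pCons a p) = (\<Sum>i\<le>Suc (degree p). \<bar>coeff (pCons a p) i\<bar>)"
    by (intro coeff_norm_altdef degree_pCons_le)
  also have "\<dots> = \<bar>a\<bar> + coeff_norm p"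
    by (subst sum.atMost_Suc_shift) (simp add: coeff_norm_def)
  finally show ?thesis .
qed

text \<open>Peeling off the constant coefficient splits the product into a multiple of
  \<open>q\<close> and a shifted product, to which the induction hypothesis applies.\<close>

lemma coeff_norm_mult: "coeff_norm (p * q) \<le> coeff_norm p * coeff_norm q"
proof (induction p)
  case 0
  then show ?case by (simp add: coeff_norm_def)
next
  case (pCons a p)
  have "coeff_norm (pCons a p * q) \<le> coeff_norm (smult a q) + coeff_norm (pCons 0 (p * q))"
    by (simp add: coeff_norm_add)
  also have "\<dots> \<le> coeff_norm (pCons a p) * coeff_norm q"
    using pCons.IH by (simp add: coeff_norm_smult coeff_norm_pCons algebra_simps)
  finally show ?case .
qed

lemma coeff_norm_power: "coeff_norm (p ^ n) \<le> coeff_norm p ^ n"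
proof (induction n)
  case 0
  then show ?case by (simp add: coeff_norm_def)
next
  case (Suc n)
  have "coeff_norm (p * p ^ n) \<le> coeff_norm p * coeff_norm (p ^ n)" by (rule coeff_norm_mult)
  also have "\<dots> \<le> coeff_norm p * coeff_norm p ^ n"
    by (intro mult_left_mono Suc coeff_norm_nonneg)
  finally show ?case by simp
qed

lemma degree_dirichlet_poly: "degree (dirichlet_poly c m) \<le> m"
proof (induction c m rule: dirichlet_poly.induct)
  case (3 c m)
  have "degree ([:2 + 4 * c, -4:] * dirichlet_poly c (Suc m)) \<le> 1 + Suc m"
    using 3 by (intro order_trans[OF degree_mult_le] add_mono) auto
  then show ?case
    using 3 by (auto intro!: degree_diff_le)
qed auto

text \<open>For \<open>c\<close> in the unit interval the polynomial for \<open>m = 1\<close> has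
  norm at most 7 + 4 = 11, and the linear factor of the recursion at most 6 + 4 = 10. The induction
  closes because 10 * 11 + 1 is at most 11 * 11.\<close>

lemma coeff_norm_dirichlet_poly:
  assumes "0 \<le> c" "c \<le> 1"
  shows "coeff_norm (dirichlet_poly c m) \<le> 11 ^ m"
  using assms
proof (induction c m rule: dirichlet_poly.induct)
  case (3 c m)
  have "coeff_norm [:2 + 4 * c, -4:] \<le> 10"
    using 3 by (simp add: coeff_norm_pCons coeff_norm_def)
  then have "coeff_norm ([:2 + 4 * c, -4:] * dirichlet_poly c (Suc m)) \<le> 10 * 11 ^ Suc m"
    using 3 by (intro order_trans[OF coeff_norm_mult] mult_mono coeff_norm_nonneg) auto
  moreover have "coeff_norm (- dirichlet_poly c m) \<le> 11 ^ m"
    using 3 by (simp add: coeff_norm_uminus)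
  moreover have "coeff_norm ([:2 + 4 * c, -4:] * dirichlet_poly c (Suc m) + - dirichlet_poly c m)
     \<le> coeff_norm ([:2 + 4 * c, -4:] * dirichlet_poly c (Suc m)) + coeff_norm (- dirichlet_poly c m)"
    by (rule coeff_norm_add)
  moreover have "10 * 11 ^ Suc m + 11 ^ m \<le> (11 ^ Suc (Suc m) :: real)" by simp
  ultimately show ?case
    unfolding dirichlet_poly.simps diff_conv_add_uminus by linarith
qed (auto simp: coeff_norm_def)

section \<open>Separation of index sets by power sums\<close>

lemma sum_inverse_squares_le: "(\<Sum>i=1..N. 1 / (real i)\<^sup>2) \<le> 2"
proof -
  \<comment> \<open>The subtracted reciprocal makes the induction telescope; starting at
    \<open>Suc N\<close> keeps the denominator nonzero.\<close>
  have "(\<Sum>i=1..Suc N. 1 / (real i)\<^sup>2) \<le> 2 - 1 / real (Suc N)" for N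
  proof (induction N)
    case (Suc N)
    have "1 / (real (Suc (Suc N)))\<^sup>2 \<le> 1 / real (Suc N) - 1 / real (Suc (Suc N))"
    proof -
      have "1 / (real (Suc (Suc N)))\<^sup>2 \<le> 1 / (real (Suc N) * real (Suc (Suc N)))"
        unfolding power2_eq_square by (intro divide_left_mono mult_right_mono) auto
      then show ?thesis by (simp add: field_simps)
    qed
    with Suc show ?case by simp
  qed simp
  from this[of "N - 1"] show ?thesis
    by (cases N) (auto intro: order_trans)
qed

text \<open>The factor \<open>11 ^ L\<close> bounds the coefficient norm of the separating
  polynomial, so power sums this close force the sums of its values over \<open>A\<close> and
  \<open>B\<close> to differ by at most 1.\<close>

lemma power_sums_separate:
  fixes n :: nat
  defines "L \<equiv> 4 * nat \<lfloor>sqrt (real n)\<rfloor>"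
  assumes "1 \<le> n" "A \<subseteq> {0..n}" "B \<subseteq> {0..n}"
  assumes close: "\<And>l. l \<le> L \<Longrightarrow>
    \<bar>(\<Sum>j\<in>A. (real j / real n) ^ l) - (\<Sum>j\<in>B. (real j / real n) ^ l)\<bar> * 11 ^ L < 1"
  shows "A = B"
proof (rule ccontr)
  assume "A \<noteq> B"
  define m where "m = nat \<lfloor>sqrt (real n)\<rfloor>"
  define D where "D = (A - B) \<union> (B - A)"
  have fin: "finite A" "finite B" "finite D"
    using assms by (auto simp: D_def intro: finite_subset)
  have "D \<noteq> {}" using \<open>A \<noteq> B\<close> by (auto simp: D_def)
  \<comment> \<open>As the least element, \<open>j0\<close> has the rest of \<open>D\<close> on its
    right, so the offsets \<open>s = (j - j0) / n\<close> lie in the unit interval, as the decay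
    bound demands.\<close>
  define j0 where "j0 = Min D"
  have j0: "j0 \<in> D" "\<And>j. j \<in> D \<Longrightarrow> j0 \<le> j"
    using fin \<open>D \<noteq> {}\<close> by (auto simp: j0_def)
  have Dn: "D \<subseteq> {0..n}" using assms by (auto simp: D_def)
  define c where "c = real j0 / real n"
  have c: "0 \<le> c" "c \<le> 1" using j0(1) Dn \<open>1 \<le> n\<close> by (auto simp: c_def)
  define q where "q = dirichlet_poly c m ^ 4"
  have deg: "degree q \<le> L"
    unfolding q_def L_def m_def[symmetric]
    using order_trans[OF degree_power_le mult_right_mono[OF degree_dirichlet_poly[of c m], of 4]]
    by (simp add: mult.commute)
  have norm: "coeff_norm q \<le> 11 ^ L"
    unfolding q_def L_def m_def[symmetric]
    by (rule order_trans[OF coeff_norm_power])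
       (use power_mono[OF coeff_norm_dirichlet_poly[OF c] coeff_norm_nonneg, of m 4]
         in \<open>simp add: mult.commute power_mult\<close>)
  define Q where "Q j = poly q (real j / real n)" for j :: nat
  have Q_nonneg: "0 \<le> Q j" for j by (simp add: Q_def q_def)
  \<comment> \<open>Integrality sharpens \<open>n < (m + 1)^2\<close> to
    \<open>n \<le> m^2 + 2 * m\<close>, and
    \<open>(2 * m + 1)^2 - 3 * (m^2 + 2 * m) = (m - 1)^2\<close> is nonnegative.\<close>
  have "sqrt (real n) < real m + 1" unfolding m_def by linarith
  then have "(sqrt (real n))\<^sup>2 < (real m + 1)\<^sup>2" by (intro power_strict_mono) auto
  then have "real n < real (m * m + 2 * m + 1)" by (simp add: power2_eq_square algebra_simps)
  then have "n < m * m + 2 * m + 1" by (simp only: of_nat_less_iff)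
  then have "real n \<le> real (m * m + 2 * m)" unfolding of_nat_le_iff by linarith
  then have "3 * real n \<le> (2 * real m + 1)\<^sup>2"
    using zero_le_power2[of "real m - 1"] by (simp add: power2_eq_square algebra_simps)
  then have "(3 * real n)\<^sup>2 \<le> ((2 * real m + 1)\<^sup>2)\<^sup>2" by (intro power_mono) auto
  also have "\<dots> = Q j0"
    by (simp add: Q_def q_def c_def[symmetric] poly_dirichlet_poly_peak)
  finally have peak: "9 * (real n)\<^sup>2 \<le> Q j0" by (simp add: power_mult_distrib)
  \<comment> \<open>The fourth power gives decay like \<open>1 / s^2\<close>, which is summable.
    With the square, the decay bound would lead to a harmonic sum of order \<open>n * log n\<close>
    against a peak of order \<open>n\<close>.\<close>
  have decay: "Q j \<le> (real n)\<^sup>2 * (1 / (real (j - j0))\<^sup>2)" if "j0 < j" "j \<le> n" for j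
  proof -
    define s where "s = real (j - j0) / real n"
    have s: "0 < s" "s \<le> 1" using that by (auto simp: s_def)
    have "real j / real n = c + s" using that by (simp add: c_def s_def field_simps)
    then have "s\<^sup>2 * Q j = (s * (poly (dirichlet_poly c m) (c + s))\<^sup>2)\<^sup>2"
      by (simp add: Q_def q_def power_mult_distrib)
    also have "\<dots> \<le> 1"
      using s poly_dirichlet_poly_decay[of s c m] by (intro power_le_one) auto
    finally have "Q j \<le> 1 / s\<^sup>2" using s by (simp add: field_simps)
    also have "\<dots> = (real n)\<^sup>2 * (1 / (real (j - j0))\<^sup>2)" by (simp add: s_def power_divide)
    finally show ?thesis .
  qed
  have "(\<Sum>j\<in>D - {j0}. Q j) \<le> (\<Sum>j=j0+1..j0+n. (real n)\<^sup>2 * (1 / (real (j - j0))\<^sup>2))"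
  proof (rule order_trans[OF sum_mono sum_mono2])
    fix j assume "j \<in> D - {j0}"
    then show "Q j \<le> (real n)\<^sup>2 * (1 / (real (j - j0))\<^sup>2)"
      using j0(2)[of j] Dn by (intro decay) auto
  next
    show "D - {j0} \<subseteq> {j0 + 1..j0 + n}" using j0(2) Dn by force
  qed auto
  also have "\<dots> = (\<Sum>i=1..n. (real n)\<^sup>2 * (1 / (real i)\<^sup>2))"
    by (rule sum.reindex_bij_witness[of _ "\<lambda>i. i + j0" "\<lambda>j. j - j0"]) auto
  also have "\<dots> \<le> 2 * (real n)\<^sup>2"
    using mult_left_mono[OF sum_inverse_squares_le[of n], of "(real n)\<^sup>2"]
    by (simp add: sum_distrib_left)
  finally have tail: "(\<Sum>j\<in>D - {j0}. Q j) \<le> 2 * (real n)\<^sup>2" .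
  have split: "sum Q A - sum Q B = sum Q (A - B) - sum Q (B - A)"
    using fin sum.Int_Diff[of A Q B] sum.Int_Diff[of B Q A] by (simp add: Int_commute)
  \<comment> \<open>Common elements cancel, and \<open>j0\<close> lies in exactly one of the two
    differences. There its value, at least \<open>9 * n^2\<close>, can be offset by at most the tail
    \<open>2 * n^2\<close>.\<close>
  have "7 * (real n)\<^sup>2 \<le> \<bar>sum Q A - sum Q B\<bar>"
  proof (cases "j0 \<in> A")
    case True
    then have "j0 \<in> A - B" "D - {j0} = (A - B - {j0}) \<union> (B - A)" using j0(1) by (auto simp: D_def)
    then have "sum Q (A - B) = Q j0 + sum Q (A - B - {j0})"
      "sum Q (D - {j0}) = sum Q (A - B - {j0}) + sum Q (B - A)"
      using fin by (auto simp: sum.remove[of "A - B" j0] intro!: sum.union_disjoint)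
    moreover have "0 \<le> sum Q (A - B - {j0})" by (intro sum_nonneg Q_nonneg)
    ultimately show ?thesis using peak tail split by linarith
  next
    case False
    then have "j0 \<in> B - A" "D - {j0} = (A - B) \<union> (B - A - {j0})" using j0(1) by (auto simp: D_def)
    then have "sum Q (B - A) = Q j0 + sum Q (B - A - {j0})"
      "sum Q (D - {j0}) = sum Q (A - B) + sum Q (B - A - {j0})"
      using fin by (auto simp: sum.remove[of "B - A" j0] intro!: sum.union_disjoint)
    moreover have "0 \<le> sum Q (B - A - {j0})" by (intro sum_nonneg Q_nonneg)
    ultimately show ?thesis using peak tail split by linarith
  qed
  moreover have "1 \<le> (real n)\<^sup>2" using \<open>1 \<le> n\<close> by simp
  ultimately have "1 < \<bar>sum Q A - sum Q B\<bar>" by linarith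
  \<comment> \<open>Expanding \<open>q\<close> into monomials and exchanging the sums exhibits the
    power sums that \<open>close\<close> controls.\<close>
  also have "sum Q A - sum Q B =
      (\<Sum>l\<le>degree q. coeff q l *
        ((\<Sum>j\<in>A. (real j / real n) ^ l) - (\<Sum>j\<in>B. (real j / real n) ^ l)))"
    unfolding Q_def poly_altdef right_diff_distrib sum_subtractf sum_distrib_left
    by (simp only: sum.swap[of _ "{..degree q}"])
  also have "\<bar>\<dots>\<bar> \<le> (\<Sum>l\<le>degree q. \<bar>coeff q l\<bar> * (1 / 11 ^ L))"
  proof (rule order_trans[OF sum_abs sum_mono])
    fix l assume "l \<in> {..degree q}"
    then have "l \<le> L" using deg by simp
    from close[OF this] show "\<bar>coeff q l *
        ((\<Sum>j\<in>A. (real j / real n) ^ l) - (\<Sum>j\<in>B. (real j / real n) ^ l))\<bar>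
        \<le> \<bar>coeff q l\<bar> * (1 / 11 ^ L)"
      unfolding abs_mult by (intro mult_left_mono) (auto simp: field_simps)
  qed
  also have "\<dots> = coeff_norm q / 11 ^ L" by (simp add: coeff_norm_def sum_divide_distrib)
  also have "\<dots> \<le> 1" using norm by simp
  finally show False by simp
qed

subsection \<open>Empirical means and moments of geometric mixtures\<close>

lemma replicate_pmf_Suc_conv_pair:
  "replicate_pmf (Suc n) M = map_pmf (\<lambda>(x, xs). x # xs) (pair_pmf M (replicate_pmf n M))"
  by (simp add: pair_pmf_def map_pmf_def bind_assoc_pmf bind_return_pmf)

text \<open>Additivity of the variance for independent centred variables. All four claims go through
  one induction, since each step uses the mean and the integrability of the shorter sum.\<close>

lemma sum_list_replicate_pmf_second_moment:
  fixes f :: "'a \<Rightarrow> real"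
  assumes f: "integrable (measure_pmf M) f" "integrable (measure_pmf M) (\<lambda>x. (f x)\<^sup>2)"
    and mean: "measure_pmf.expectation M f = 0"
  defines "S \<equiv> \<lambda>xs. sum_list (map f xs)"
  shows "integrable (measure_pmf (replicate_pmf n M)) S"
    and "measure_pmf.expectation (replicate_pmf n M) S = 0"
    and "integrable (measure_pmf (replicate_pmf n M)) (\<lambda>xs. (S xs)\<^sup>2)"
    and "measure_pmf.expectation (replicate_pmf n M) (\<lambda>xs. (S xs)\<^sup>2) =
           real n * measure_pmf.expectation M (\<lambda>x. (f x)\<^sup>2)"
proof -
  define V where "V = measure_pmf.expectation M (\<lambda>x. (f x)\<^sup>2)"
  have V: "0 \<le> V" by (simp add: V_def)
  have "integrable (measure_pmf (replicate_pmf n M)) S \<and>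
    measure_pmf.expectation (replicate_pmf n M) S = 0 \<and>
    integrable (measure_pmf (replicate_pmf n M)) (\<lambda>xs. (S xs)\<^sup>2) \<and>
    measure_pmf.expectation (replicate_pmf n M) (\<lambda>xs. (S xs)\<^sup>2) = real n * V"
  proof (induction n)
    case 0
    then show ?case by (simp add: S_def integrable_measure_pmf_finite)
  next
    case (Suc n)
    define R where "R = replicate_pmf n M"
    define P where "P = pair_pmf M R"
    have IH: "integrable (measure_pmf R) S" "measure_pmf.expectation R S = 0"
      "integrable (measure_pmf R) (\<lambda>xs. (S xs)\<^sup>2)"
      "measure_pmf.expectation R (\<lambda>xs. (S xs)\<^sup>2) = real n * V"
      using Suc by (simp_all add: R_def)
    have fst: "integrable (measure_pmf P) (\<lambda>z. f (fst z))"
      using f(1) integrable_map_pmf_eq[of fst P f] by (simp add: P_def map_fst_pair_pmf)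
    have snd: "integrable (measure_pmf P) (\<lambda>z. S (snd z))"
      using IH(1) integrable_map_pmf_eq[of snd P S] by (simp add: P_def map_snd_pair_pmf)
    have S: "S (case z of (x, xs) \<Rightarrow> x # xs) = f (fst z) + S (snd z)" for z
      by (simp add: S_def split_beta)
    \<comment> \<open>With \<open>x\<close> fixed, the cross term \<open>2 * f x * S xs\<close>
      integrates to 0 because \<open>S\<close> has mean 0.\<close>
    have inner: "(\<integral>\<^sup>+xs. ennreal ((f x + S xs)\<^sup>2) \<partial>R) = ennreal ((f x)\<^sup>2 + real n * V)" for x
    proof -
      have eq: "(f x + S xs)\<^sup>2 = ((f x)\<^sup>2 + 2 * f x * S xs) + (S xs)\<^sup>2" for xs
        by (simp add: power2_sum)
      have int: "integrable (measure_pmf R) (\<lambda>xs. (f x + S xs)\<^sup>2)"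
        unfolding eq using IH by auto
      have "measure_pmf.expectation R (\<lambda>xs. (f x + S xs)\<^sup>2) = (f x)\<^sup>2 + real n * V"
        unfolding eq using IH by simp
      then show ?thesis using int by (simp add: nn_integral_eq_integral)
    qed
    have "(\<integral>\<^sup>+z. ennreal ((f (fst z) + S (snd z))\<^sup>2) \<partial>P) =
        (\<integral>\<^sup>+x. ennreal ((f x)\<^sup>2 + real n * V) \<partial>M)"
      by (simp add: P_def nn_integral_pair_pmf' inner)
    also have "\<dots> = ennreal (real (Suc n) * V)"
      using f V by (subst nn_integral_eq_integral) (auto simp: V_def algebra_simps)
    finally have nn: "(\<integral>\<^sup>+z. ennreal ((f (fst z) + S (snd z))\<^sup>2) \<partial>P) = ennreal (real (Suc n) * V)" .
    \<comment> \<open>The iterated integral of a nonnegative function presupposes no integrability;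
      its finite value now supplies it.\<close>
    have int: "integrable (measure_pmf P) (\<lambda>z. (f (fst z) + S (snd z))\<^sup>2)"
      by (rule integrableI_nonneg) (simp_all add: nn)
    have "measure_pmf.expectation P (\<lambda>z. (f (fst z) + S (snd z))\<^sup>2) = real (Suc n) * V"
      using V nn by (subst integral_eq_nn_integral) auto
    moreover have "measure_pmf.expectation P (\<lambda>z. f (fst z) + S (snd z)) = 0"
      using fst snd mean IH(2) by (simp add: P_def)
    ultimately show ?case
      using fst snd int unfolding replicate_pmf_Suc_conv_pair R_def[symmetric] P_def[symmetric]
      by (simp add: S)
  qed
  then show "integrable (measure_pmf (replicate_pmf n M)) S"
    and "measure_pmf.expectation (replicate_pmf n M) S = 0"
    and "integrable (measure_pmf (replicate_pmf n M)) (\<lambda>xs. (S xs)\<^sup>2)"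
    and "measure_pmf.expectation (replicate_pmf n M) (\<lambda>xs. (S xs)\<^sup>2) =
           real n * measure_pmf.expectation M (\<lambda>x. (f x)\<^sup>2)"
    by (simp_all add: V_def)
qed

text \<open>Chebyshev's inequality: Markov's inequality for the squared centred sum. The variance is
  relaxed to the raw second moment, for which a bound is at hand later.\<close>

lemma prob_empirical_mean_deviation:
  fixes h :: "'a \<Rightarrow> real"
  assumes h: "integrable (measure_pmf M) h" "integrable (measure_pmf M) (\<lambda>x. (h x)\<^sup>2)"
    and "0 < m" "0 < t"
  shows "measure_pmf.prob (replicate_pmf m M)
      {xs. t \<le> \<bar>sum_list (map h xs) / real m - measure_pmf.expectation M h\<bar>}
    \<le> measure_pmf.expectation M (\<lambda>x. (h x)\<^sup>2) / (real m * t\<^sup>2)"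
proof -
  define \<mu> where "\<mu> = measure_pmf.expectation M h"
  define f where "f x = h x - \<mu>" for x
  define R where "R = replicate_pmf m M"
  have f2: "(f x)\<^sup>2 = ((h x)\<^sup>2 - 2 * \<mu> * h x) + \<mu>\<^sup>2" for x
    by (simp add: f_def power2_eq_square algebra_simps)
  have f: "integrable (measure_pmf M) f" "integrable (measure_pmf M) (\<lambda>x. (f x)\<^sup>2)"
    "measure_pmf.expectation M f = 0"
    using h unfolding f2 by (auto simp: f_def[abs_def] \<mu>_def)
  have var: "measure_pmf.expectation M (\<lambda>x. (f x)\<^sup>2) = measure_pmf.expectation M (\<lambda>x. (h x)\<^sup>2) - \<mu>\<^sup>2"
    unfolding f2 using h by (simp add: \<mu>_def[symmetric] power2_eq_square)
  note R = sum_list_replicate_pmf_second_moment[OF f, of m, folded R_def]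
  \<comment> \<open>Centring the sum uses \<open>length xs = m\<close>, which holds only on the
    support; hence the almost-everywhere form of monotonicity below.\<close>
  have "{xs \<in> set_pmf R. t \<le> \<bar>sum_list (map h xs) / real m - \<mu>\<bar>} \<subseteq>
     {xs. (t * real m)\<^sup>2 \<le> (sum_list (map f xs))\<^sup>2}"
  proof safe
    fix xs assume "xs \<in> set_pmf R" and dev: "t \<le> \<bar>sum_list (map h xs) / real m - \<mu>\<bar>"
    then have "length xs = m" by (simp add: R_def set_replicate_pmf)
    then have "sum_list (map f xs) = sum_list (map h xs) - real m * \<mu>"
      by (simp add: f_def[abs_def] sum_list_subtractf sum_list_triv)
    then have "sum_list (map f xs) = real m * (sum_list (map h xs) / real m - \<mu>)"
      using \<open>0 < m\<close> by (simp add: right_diff_distrib)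
    then have "\<bar>sum_list (map f xs)\<bar> = real m * \<bar>sum_list (map h xs) / real m - \<mu>\<bar>"
      by (simp only: abs_mult abs_of_nat)
    then have "t * real m \<le> \<bar>sum_list (map f xs)\<bar>"
      using mult_left_mono[OF dev, of "real m"] by (simp add: mult.commute)
    then have "(t * real m)\<^sup>2 \<le> \<bar>sum_list (map f xs)\<bar>\<^sup>2"
      using \<open>0 < t\<close> by (intro power_mono) auto
    then show "(t * real m)\<^sup>2 \<le> (sum_list (map f xs))\<^sup>2" by simp
  qed
  then have "measure_pmf.prob R {xs. t \<le> \<bar>sum_list (map h xs) / real m - \<mu>\<bar>}
      \<le> measure_pmf.prob R {xs. (t * real m)\<^sup>2 \<le> (sum_list (map f xs))\<^sup>2}"
    by (intro measure_pmf.finite_measure_mono_AE) (auto simp: AE_measure_pmf_iff)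
  also have "\<dots> \<le> measure_pmf.expectation R (\<lambda>xs. (sum_list (map f xs))\<^sup>2) / (t * real m)\<^sup>2"
    using integral_Markov_inequality_measure[of "measure_pmf R" "\<lambda>xs. (sum_list (map f xs))\<^sup>2" UNIV "(t * real m)\<^sup>2"]
      R(3) assms by simp
  also have "\<dots> \<le> measure_pmf.expectation M (\<lambda>x. (h x)\<^sup>2) / (real m * t\<^sup>2)"
  proof -
    have "measure_pmf.expectation R (\<lambda>xs. (sum_list (map f xs))\<^sup>2)
        \<le> real m * measure_pmf.expectation M (\<lambda>x. (h x)\<^sup>2)"
      unfolding R(4) var by (intro mult_left_mono) auto
    then have "measure_pmf.expectation R (\<lambda>xs. (sum_list (map f xs))\<^sup>2) / (t * real m)\<^sup>2
        \<le> real m * measure_pmf.expectation M (\<lambda>x. (h x)\<^sup>2) / (t * real m)\<^sup>2"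
      by (rule divide_right_mono) simp
    then show ?thesis using assms by (simp add: power2_eq_square mult_ac)
  qed
  finally show ?thesis by (simp add: R_def \<mu>_def)
qed

section \<open>Binomial moments of geometric mixtures\<close>

lemma has_expectation_nat_pmf:
  fixes M :: "nat pmf" and h :: "nat \<Rightarrow> real"
  assumes "\<And>x. 0 \<le> h x" "(\<lambda>x. pmf M x * h x) sums s"
  shows "integrable (measure_pmf M) h" "measure_pmf.expectation M h = s"
proof -
  have int: "integrable (count_space UNIV) (\<lambda>x. pmf M x * h x)"
    using assms sums_summable[OF assms(2)] by (simp add: integrable_count_space_nat_iff)
  then show "integrable (measure_pmf M) h"
    by (simp add: measure_pmf_eq_density integrable_density)
  show "measure_pmf.expectation M h = s"
    using integral_count_space_nat[OF int] assms(2)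
    by (simp add: measure_pmf_eq_density integral_density sums_iff)
qed

text \<open>This is the normalisation of the negative binomial distribution with parameter
  \<open>Suc b\<close>, rescaled and shifted by \<open>b - a\<close>.\<close>

lemma binomial_geometric_sums:
  fixes r :: real
  assumes "0 \<le> r" "r < 1" "a \<le> b"
  shows "(\<lambda>x. real ((x + a) choose b) * r ^ x) sums (r ^ (b - a) / (1 - r) ^ Suc b)"
proof -
  define p where "p = 1 - r"
  have p: "p \<in> {0<..1}" using assms by (simp add: p_def)
  have "(\<lambda>y. pmf (neg_binomial_pmf (Suc b) p) y) sums 1"
  proof -
    have "integrable (count_space UNIV) (\<lambda>y. pmf (neg_binomial_pmf (Suc b) p) y)"
      by (rule integrable_pmf)
    from sums_integral_count_space_nat[OF this] show ?thesis
      by (simp add: integral_pmf)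
  qed
  then have "(\<lambda>y. real ((y + b) choose y) * p ^ Suc b * r ^ y) sums 1"
    using p by (simp add: pmf_neg_binomial p_def)
  from sums_mult[OF this, of "r ^ (b - a) / p ^ Suc b"]
  have *: "(\<lambda>y. real ((y + b) choose y) * r ^ (y + (b - a))) sums (r ^ (b - a) / p ^ Suc b)"
    using p by (simp add: power_add field_simps)
  have "(\<lambda>y. real ((y + (b - a) + a) choose b) * r ^ (y + (b - a))) sums (r ^ (b - a) / p ^ Suc b)"
    using * \<open>a \<le> b\<close> by (simp add: binomial_symmetric[of b "_ + b"])
  \<comment> \<open>The \<open>b - a\<close> terms skipped by the shift vanish, since
    \<open>x + a < b\<close> there.\<close>
  then show ?thesis
    unfolding p_def
    by (subst (asm) sums_zero_iff_shift) (use assms in \<open>auto simp: binomial_eq_0\<close>)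
qed

text \<open>The factor \<open>p i\<close> of the pmf cancels one power of the denominator of the
  series. The case \<open>a = 0\<close>, \<open>b = l\<close> gives the means to be estimated;
  \<open>a = l\<close>, \<open>b = 2 * l\<close> serves to bound their second moments.\<close>

lemma expectation_binomial_geo_mixture:
  assumes "1 \<le> k" "\<And>i. i \<in> {1..k} \<Longrightarrow> 0 < p i \<and> p i \<le> 1" "a \<le> b"
  shows "integrable (geo_mixture k p) (\<lambda>x. real ((x + a) choose b))"
    and "measure_pmf.expectation (geo_mixture k p) (\<lambda>x. real ((x + a) choose b)) =
      1 / real k * (\<Sum>i=1..k. (1 - p i) ^ (b - a) / p i ^ b)"
proof -
  have "(\<lambda>x. p i * (real ((x + a) choose b) * (1 - p i) ^ x)) sums ((1 - p i) ^ (b - a) / p i ^ b)"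
    if "i \<in> {1..k}" for i
    using sums_mult[OF binomial_geometric_sums[of "1 - p i" a b], of "p i"] assms(2)[OF that] \<open>a \<le> b\<close>
    by simp
  then have "(\<lambda>x. 1 / real k * (\<Sum>i=1..k. p i * (real ((x + a) choose b) * (1 - p i) ^ x))) sums
      (1 / real k * (\<Sum>i=1..k. (1 - p i) ^ (b - a) / p i ^ b))"
    by (intro sums_mult sums_sum) auto
  also have "(\<lambda>x. 1 / real k * (\<Sum>i=1..k. p i * (real ((x + a) choose b) * (1 - p i) ^ x))) =
      (\<lambda>x. pmf (geo_mixture k p) x * real ((x + a) choose b))"
    using pmf_geo_mixture[of k p, OF assms(1,2)]
    by (simp add: fun_eq_iff sum_distrib_left sum_distrib_right mult_ac)
  finally show "integrable (geo_mixture k p) (\<lambda>x. real ((x + a) choose b))"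
    and "measure_pmf.expectation (geo_mixture k p) (\<lambda>x. real ((x + a) choose b)) =
      1 / real k * (\<Sum>i=1..k. (1 - p i) ^ (b - a) / p i ^ b)"
    using has_expectation_nat_pmf[of "\<lambda>x. real ((x + a) choose b)"] by auto
qed

text \<open>Replaces a square by a single binomial coefficient whose mean is known in closed form.
  After raising one factor to \<open>(x + l) choose l\<close>, the product is
  \<open>(x + l) choose (2 * l)\<close> times a central binomial coefficient.\<close>

lemma choose_squared_le: "(x choose l)\<^sup>2 \<le> 4 ^ l * ((x + l) choose (2 * l))"
proof (cases "l \<le> x")
  case True
  have "(x choose l)\<^sup>2 \<le> ((x + l) choose l) * (x choose l)"
    using binomial_right_mono[of x "x + l" l] by (simp add: power2_eq_square)
  also have "\<dots> = ((x + l) choose (2 * l)) * ((2 * l) choose l)"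
    using choose_mult[of l "2 * l" "x + l"] True by simp
  also have "\<dots> \<le> ((x + l) choose (2 * l)) * 2 ^ (2 * l)"
    by (intro mult_left_mono binomial_le_pow2) auto
  also have "(2::nat) ^ (2 * l) = 4 ^ l" by (simp add: power_mult)
  finally show ?thesis by (simp only: mult.commute)
qed (simp add: binomial_eq_0)

subsection \<open>Recovering the parameters\<close>

text \<open>The falling factorial over \<open>fact l\<close>; it makes the mean of
  \<open>x choose l\<close> a combination of moments of order at most \<open>l\<close>.\<close>

lemma binomial_as_poly:
  obtains P :: "real poly" where "degree P \<le> l" "\<And>x. poly P (real x) = real (x choose l)"
proof
  let ?P = "smult (1 / fact l) (\<Prod>i<l. [:- real i, 1:])"
  have "degree (\<Prod>i<l. [:- real i, 1:]) \<le> (\<Sum>i<l. degree [:- real i, 1:])"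
    by (rule order_trans[OF degree_prod_sum_le]) auto
  then show "degree ?P \<le> l" by (simp add: order_trans[OF degree_smult_le])
  show "poly ?P (real x) = real (x choose l)" for x
    by (simp add: binomial_gbinomial gbinomial_prod_rev poly_prod lessThan_atLeast0)
qed

text \<open>For \<open>v = 1 / (1 + j * \<epsilon>)\<close> the odds \<open>(1 - v) / v\<close>
  equal \<open>j * \<epsilon>\<close>. Distinctness of the \<open>p i\<close> makes every index in
  \<open>J\<close> count once, whatever the numbering of the components.\<close>

lemma power_sum_geo_params:
  fixes n :: nat and p :: "nat \<Rightarrow> real" and \<epsilon> :: real
  assumes "0 < \<epsilon>" "geo_params k n \<epsilon> p"
  defines "J \<equiv> {j \<in> {0..n}. 1 / (1 + real j * \<epsilon>) \<in> p ` {1..k}}"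
  shows "p ` {1..k} = (\<lambda>j. 1 / (1 + real j * \<epsilon>)) ` J"
    and "(\<Sum>i=1..k. (1 - p i) ^ l / p i ^ l) = \<epsilon> ^ l * (\<Sum>j\<in>J. real j ^ l)"
proof -
  define g where "g j = 1 / (1 + real j * \<epsilon>)" for j :: nat
  have pos: "0 < 1 + real j * \<epsilon>" for j :: nat
    using assms(1) by (simp add: add_pos_nonneg)
  have inj: "inj_on g J"
    using assms(1) pos by (intro inj_onI) (auto simp: g_def)
  have p: "inj_on p {1..k}" "p ` {1..k} \<subseteq> g ` {0..n}"
    using assms(2) by (auto simp: geo_params_def g_def[abs_def])
  show image: "p ` {1..k} = (\<lambda>j. 1 / (1 + real j * \<epsilon>)) ` J"
  proof -
    have "S = g ` {j \<in> {0..n}. g j \<in> S}" if "S \<subseteq> g ` {0..n}" for S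
      using that by blast
    from this[OF p(2)] show ?thesis unfolding J_def g_def .
  qed
  have "(\<Sum>i=1..k. (1 - p i) ^ l / p i ^ l) = (\<Sum>v\<in>p ` {1..k}. (1 - v) ^ l / v ^ l)"
    using p(1) by (simp add: sum.reindex)
  also have "\<dots> = (\<Sum>j\<in>J. (1 - g j) ^ l / g j ^ l)"
    unfolding image g_def[symmetric] using inj by (simp add: sum.reindex)
  also have "\<dots> = (\<Sum>j\<in>J. \<epsilon> ^ l * real j ^ l)"
  proof (rule sum.cong)
    fix j
    have "(1 - g j) / g j = \<epsilon> * real j"
      using pos[of j] by (simp add: g_def field_simps)
    then show "(1 - g j) ^ l / g j ^ l = \<epsilon> ^ l * real j ^ l"
      by (simp only: flip: power_divide power_mult_distrib)
  qed simp
  finally show "(\<Sum>i=1..k. (1 - p i) ^ l / p i ^ l) = \<epsilon> ^ l * (\<Sum>j\<in>J. real j ^ l)"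
    by (simp add: sum_distrib_left)
qed

text \<open>The mean of \<open>x choose l\<close> is \<open>(n * \<epsilon>)^l / k\<close> times the
  power sum over the nodes \<open>j / n\<close>, so dividing by this factor turns
  \<open>close\<close> into the hypothesis of \<open>power_sums_separate\<close>.\<close>

lemma geo_params_eqI:
  fixes n :: nat
  defines "L \<equiv> 4 * nat \<lfloor>sqrt (real n)\<rfloor>"
  assumes "0 < \<epsilon>" "1 \<le> n" "1 \<le> k" "geo_params k n \<epsilon> p" "geo_params k n \<epsilon> q"
  assumes close: "\<And>l. l \<le> L \<Longrightarrow>
    \<bar>measure_pmf.expectation (geo_mixture k p) (\<lambda>x. real (x choose l)) -
     measure_pmf.expectation (geo_mixture k q) (\<lambda>x. real (x choose l))\<bar> * (real k * 11 ^ L)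
    < (real n * \<epsilon>) ^ l"
  shows "p ` {1..k} = q ` {1..k}"
proof -
  define J where "J r = {j \<in> {0..n}. 1 / (1 + real j * \<epsilon>) \<in> r ` {1..k}}" for r :: "nat \<Rightarrow> real"
  have E: "measure_pmf.expectation (geo_mixture k r) (\<lambda>x. real (x choose l)) =
      (real n * \<epsilon>) ^ l / real k * (\<Sum>j\<in>J r. (real j / real n) ^ l)"
    if "geo_params k n \<epsilon> r" for r l
  proof -
    have "measure_pmf.expectation (geo_mixture k r) (\<lambda>x. real (x choose l)) =
        1 / real k * (\<Sum>i=1..k. (1 - r i) ^ l / r i ^ l)"
      using expectation_binomial_geo_mixture(2)[of k r 0 l] geo_params_bounds[OF \<open>0 < \<epsilon>\<close> that] \<open>1 \<le> k\<close>
      by simp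
    also have "\<dots> = 1 / real k * (\<epsilon> ^ l * (\<Sum>j\<in>J r. real j ^ l))"
      unfolding power_sum_geo_params(2)[OF \<open>0 < \<epsilon>\<close> that] J_def ..
    also have "(\<Sum>j\<in>J r. real j ^ l) = real n ^ l * (\<Sum>j\<in>J r. (real j / real n) ^ l)"
      using \<open>1 \<le> n\<close> by (simp add: sum_distrib_left power_divide)
    finally show ?thesis by (simp add: power_mult_distrib)
  qed
  have "J p = J q"
  proof (rule power_sums_separate)
    show "1 \<le> n" by fact
    show "J p \<subseteq> {0..n}" "J q \<subseteq> {0..n}" by (auto simp: J_def)
    fix l assume "l \<le> 4 * nat \<lfloor>sqrt (real n)\<rfloor>"
    then have "l \<le> L" by (simp add: L_def)
    define d where "d = (\<Sum>j\<in>J p. (real j / real n) ^ l) - (\<Sum>j\<in>J q. (real j / real n) ^ l)"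
    have pos: "0 < (real n * \<epsilon>) ^ l" using assms by simp
    have "\<bar>(real n * \<epsilon>) ^ l / real k * d\<bar> * (real k * 11 ^ L) < (real n * \<epsilon>) ^ l"
      using close[OF \<open>l \<le> L\<close>] unfolding E[OF assms(5)] E[OF assms(6)] d_def right_diff_distrib .
    also have "\<bar>(real n * \<epsilon>) ^ l / real k * d\<bar> = (real n * \<epsilon>) ^ l / real k * \<bar>d\<bar>"
      using pos by (simp add: abs_mult)
    also have "\<dots> * (real k * 11 ^ L) = (real n * \<epsilon>) ^ l * (\<bar>d\<bar> * 11 ^ L)"
      using \<open>1 \<le> k\<close> by simp
    finally have "\<bar>d\<bar> * 11 ^ L < 1" using pos by simp
    then show "\<bar>(\<Sum>j\<in>J p. (real j / real n) ^ l) - (\<Sum>j\<in>J q. (real j / real n) ^ l)\<bar>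
        * 11 ^ (4 * nat \<lfloor>sqrt (real n)\<rfloor>) < 1"
      by (simp only: d_def L_def)
  qed
  then show ?thesis
    using power_sum_geo_params(1)[OF \<open>0 < \<epsilon>\<close> assms(5)]
      power_sum_geo_params(1)[OF \<open>0 < \<epsilon>\<close> assms(6)] unfolding J_def by argo
qed

lemma moments_determine_geo_params:
  fixes n :: nat
  assumes "0 < \<epsilon>" "1 \<le> n" "1 \<le> k" "geo_params k n \<epsilon> p" "geo_params k n \<epsilon> q"
  assumes moments: "\<And>l::nat. real l \<le> 4 * sqrt (real n) \<Longrightarrow>
    measure_pmf.expectation (geo_mixture k p) (\<lambda>x. real x ^ l) =
    measure_pmf.expectation (geo_mixture k q) (\<lambda>x. real x ^ l)"
  shows "p ` {1..k} = q ` {1..k}"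
proof (rule geo_params_eqI)
  fix l assume l: "l \<le> 4 * nat \<lfloor>sqrt (real n)\<rfloor>"
  obtain P :: "real poly" where P: "degree P \<le> l" "\<And>x. poly P (real x) = real (x choose l)"
    using binomial_as_poly by blast
  have E: "measure_pmf.expectation (geo_mixture k r) (\<lambda>x. real (x choose l)) =
      (\<Sum>i\<le>degree P. coeff P i * measure_pmf.expectation (geo_mixture k r) (\<lambda>x. real x ^ i))"
    if "geo_params k n \<epsilon> r" for r
    unfolding P(2)[symmetric] poly_altdef
    using integrable_geo_mixture_moment[of k r] geo_params_bounds[OF \<open>0 < \<epsilon>\<close> that] \<open>1 \<le> k\<close>
    by (subst Bochner_Integration.integral_sum) auto
  \<comment> \<open>Rounding the square root down keeps every moment that occurs within the assumed
    range.\<close>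
  have "real i \<le> 4 * sqrt (real n)" if "i \<le> degree P" for i
  proof -
    have "i \<le> 4 * nat \<lfloor>sqrt (real n)\<rfloor>" using that P(1) l by linarith
    then have "real i \<le> real (4 * nat \<lfloor>sqrt (real n)\<rfloor>)" by (simp only: of_nat_le_iff)
    also have "\<dots> \<le> 4 * sqrt (real n)" by simp
    finally show ?thesis .
  qed
  then have "measure_pmf.expectation (geo_mixture k p) (\<lambda>x. real (x choose l)) =
     measure_pmf.expectation (geo_mixture k q) (\<lambda>x. real (x choose l))"
    unfolding E[OF assms(4)] E[OF assms(5)] by (intro sum.cong) (auto simp: moments)
  then show "\<bar>measure_pmf.expectation (geo_mixture k p) (\<lambda>x. real (x choose l)) -
     measure_pmf.expectation (geo_mixture k q) (\<lambda>x. real (x choose l))\<bar> *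
     (real k * 11 ^ (4 * nat \<lfloor>sqrt (real n)\<rfloor>)) < (real n * \<epsilon>) ^ l"
    using assms by simp
qed (use assms in auto)

text \<open>
  The tolerance is half the separation required in \<open>geo_params_eqI\<close>, so at most one parameter set is
  consistent with a sample.  If there is none, the estimator returns an arbitrary set.
\<close>

definition consistent_with_sample ::
  "nat \<Rightarrow> nat \<Rightarrow> real \<Rightarrow> nat \<Rightarrow> nat list \<Rightarrow> (nat \<Rightarrow> real) \<Rightarrow> bool" where
  "consistent_with_sample k n \<epsilon> m xs p \<longleftrightarrow>
     (\<forall>l \<le> 4 * nat \<lfloor>sqrt (real n)\<rfloor>.
        \<bar>sum_list (map (\<lambda>x. real (x choose l)) xs) / real m -
         measure_pmf.expectation (geo_mixture k p) (\<lambda>x. real (x choose l))\<bar>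
        < (real n * \<epsilon>) ^ l / (2 * real k * 11 ^ (4 * nat \<lfloor>sqrt (real n)\<rfloor>)))"

definition geo_estimator :: "nat \<Rightarrow> nat \<Rightarrow> real \<Rightarrow> nat \<Rightarrow> nat list \<Rightarrow> real set" where
  "geo_estimator k n \<epsilon> m xs =
     (SOME p. geo_params k n \<epsilon> p \<and> consistent_with_sample k n \<epsilon> m xs p) ` {1..k}"

text \<open>The chosen \<open>q\<close> and the true \<open>p\<close> are both within half the
  separation of the same empirical means, so the triangle inequality identifies their images, though
  not the functions.\<close>

lemma geo_estimator_eqI:
  assumes "0 < \<epsilon>" "1 \<le> n" "1 \<le> k" "geo_params k n \<epsilon> p" "consistent_with_sample k n \<epsilon> m xs p"
  shows "geo_estimator k n \<epsilon> m xs = p ` {1..k}"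
proof -
  define q where "q = (SOME p. geo_params k n \<epsilon> p \<and> consistent_with_sample k n \<epsilon> m xs p)"
  have q: "geo_params k n \<epsilon> q" "consistent_with_sample k n \<epsilon> m xs q"
    using someI[of "\<lambda>p. geo_params k n \<epsilon> p \<and> consistent_with_sample k n \<epsilon> m xs p" p] assms
    by (auto simp: q_def)
  have "q ` {1..k} = p ` {1..k}"
  proof (rule geo_params_eqI)
    fix l assume l: "l \<le> 4 * nat \<lfloor>sqrt (real n)\<rfloor>"
    define T :: real where "T = real k * 11 ^ (4 * nat \<lfloor>sqrt (real n)\<rfloor>)"
    have T: "0 < T" using \<open>1 \<le> k\<close> by (simp add: T_def)
    let ?E = "\<lambda>r. measure_pmf.expectation (geo_mixture k r) (\<lambda>x. real (x choose l))"
    let ?m = "sum_list (map (\<lambda>x. real (x choose l)) xs) / real m"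
    have "\<bar>?m - ?E p\<bar> < (real n * \<epsilon>) ^ l / (2 * T)" "\<bar>?m - ?E q\<bar> < (real n * \<epsilon>) ^ l / (2 * T)"
      using assms(5) q(2) l by (simp_all add: consistent_with_sample_def T_def mult.assoc)
    then have "\<bar>?E q - ?E p\<bar> < (real n * \<epsilon>) ^ l / (2 * T) + (real n * \<epsilon>) ^ l / (2 * T)"
      by linarith
    also have "\<dots> = (real n * \<epsilon>) ^ l / T" using T by (simp add: field_simps)
    finally show "\<bar>?E q - ?E p\<bar> * (real k * 11 ^ (4 * nat \<lfloor>sqrt (real n)\<rfloor>)) < (real n * \<epsilon>) ^ l"
      using T unfolding T_def[symmetric] by (simp add: field_simps)
  qed (use assms q in auto)
  then show ?thesis by (simp add: geo_estimator_def q_def)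
qed

section \<open>Error probability and sample size of the estimator\<close>

lemma binomial_second_moment_geo_mixture:
  assumes "0 < \<epsilon>" "1 \<le> k" "geo_params k n \<epsilon> p"
  shows "integrable (geo_mixture k p) (\<lambda>x. (real (x choose l))\<^sup>2)"
    and "measure_pmf.expectation (geo_mixture k p) (\<lambda>x. (real (x choose l))\<^sup>2)
      \<le> (2 * (1 + real n * \<epsilon>)) ^ (2 * l)"
proof -
  note bounds = geo_params_bounds[OF assms(1,3)]
  have b: "(real (x choose l))\<^sup>2 \<le> 4 ^ l * real ((x + l) choose (2 * l))" for x
  proof -
    have "real ((x choose l)\<^sup>2) \<le> real (4 ^ l * ((x + l) choose (2 * l)))"
      by (simp only: of_nat_le_iff choose_squared_le)
    then show ?thesis by simp
  qed
  note moment = expectation_binomial_geo_mixture[of k p l "2 * l"]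
  have int: "integrable (geo_mixture k p) (\<lambda>x. 4 ^ l * real ((x + l) choose (2 * l)))"
    using moment(1) assms bounds by simp
  then show int': "integrable (geo_mixture k p) (\<lambda>x. (real (x choose l))\<^sup>2)"
    by (rule Bochner_Integration.integrable_bound) (use b in auto)
  have "measure_pmf.expectation (geo_mixture k p) (\<lambda>x. (real (x choose l))\<^sup>2)
      \<le> measure_pmf.expectation (geo_mixture k p) (\<lambda>x. 4 ^ l * real ((x + l) choose (2 * l)))"
    by (intro integral_mono int int' b)
  also have "\<dots> = 4 ^ l * (1 / real k * (\<Sum>i=1..k. (1 - p i) ^ l / p i ^ (2 * l)))"
    using moment(2) assms bounds by simp
  also have "\<dots> \<le> 4 ^ l * (1 / real k * (\<Sum>i=1..k. (1 + real n * \<epsilon>) ^ (2 * l)))"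
  \<comment> \<open>Each numerator is at most 1 and each \<open>1 / p i\<close> at most
    \<open>1 + n * \<epsilon>\<close>.\<close>
  proof (intro mult_left_mono sum_mono)
    fix i assume i: "i \<in> {1..k}"
    then obtain j where j: "j \<le> n" "p i = 1 / (1 + real j * \<epsilon>)"
      using assms(3) by (fastforce simp: geo_params_def)
    have "(1 - p i) ^ l / p i ^ (2 * l) \<le> 1 / p i ^ (2 * l)"
      using bounds[OF i] by (intro divide_right_mono power_le_one) auto
    also have "\<dots> = (1 + real j * \<epsilon>) ^ (2 * l)"
      by (simp add: j power_divide)
    also have "\<dots> \<le> (1 + real n * \<epsilon>) ^ (2 * l)"
      using j(1) assms(1) by (intro power_mono add_mono mult_right_mono) auto
    finally show "(1 - p i) ^ l / p i ^ (2 * l) \<le> (1 + real n * \<epsilon>) ^ (2 * l)" .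
  qed auto
  also have "\<dots> = (2 * (1 + real n * \<epsilon>)) ^ (2 * l)"
    using \<open>1 \<le> k\<close> by (simp only: power_mult_distrib power_mult) simp
  finally show "measure_pmf.expectation (geo_mixture k p) (\<lambda>x. (real (x choose l))\<^sup>2)
      \<le> (2 * (1 + real n * \<epsilon>)) ^ (2 * l)" .
qed

text \<open>A union bound over the \<open>L + 1\<close> orders, each handled by Chebyshev's
  inequality. The base 1936 is \<open>11^2 * 4^2\<close>: 11 comes from the tolerance, 4 from
  comparing the second moment with \<open>(n * \<epsilon>)^(2 * l)\<close>.\<close>

lemma prob_geo_estimator_error:
  fixes n :: nat
  defines "L \<equiv> 4 * nat \<lfloor>sqrt (real n)\<rfloor>"
  assumes "0 < \<epsilon>" "\<epsilon> \<le> 1" "1 \<le> n" "1 \<le> k" "0 < m" "geo_params k n \<epsilon> p"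
  shows "measure_pmf.prob (replicate_pmf m (geo_mixture k p))
      {xs. geo_estimator k n \<epsilon> m xs \<noteq> p ` {1..k}}
    \<le> 4 * (real L + 1) * 1936 ^ L * (real k)\<^sup>2 * (1 / \<epsilon>) ^ (2 * L) / real m"
proof -
  let ?R = "replicate_pmf m (geo_mixture k p)"
  define T :: real where "T = 2 * real k * 11 ^ L"
  have T: "0 < T" using \<open>1 \<le> k\<close> by (simp add: T_def)
  define bad where "bad l = {xs. (real n * \<epsilon>) ^ l / T \<le>
    \<bar>sum_list (map (\<lambda>x. real (x choose l)) xs) / real m -
     measure_pmf.expectation (geo_mixture k p) (\<lambda>x. real (x choose l))\<bar>}" for l
  have bad: "measure_pmf.prob ?R (bad l) \<le> T\<^sup>2 * (4 / \<epsilon>) ^ (2 * L) / real m" if "l \<le> L" for l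
  proof -
    let ?V = "measure_pmf.expectation (geo_mixture k p) (\<lambda>x. (real (x choose l))\<^sup>2)"
    define u where "u = real n * \<epsilon>"
    have u: "0 < u" using assms by (simp add: u_def)
    have int: "integrable (geo_mixture k p) (\<lambda>x. real (x choose l))"
      using expectation_binomial_geo_mixture(1)[of k p 0 l] assms geo_params_bounds[of \<epsilon> k n p] by simp
    have "measure_pmf.prob ?R (bad l) \<le> ?V / (real m * (u ^ l / T)\<^sup>2)"
      unfolding bad_def u_def[symmetric]
      using assms T u
      by (intro prob_empirical_mean_deviation int binomial_second_moment_geo_mixture(1)) auto
    also have "\<dots> \<le> (2 * (1 + u)) ^ (2 * l) / (real m * (u ^ l / T)\<^sup>2)"
      unfolding u_def using assms by (intro divide_right_mono binomial_second_moment_geo_mixture(2)) auto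
    also have "\<dots> = T\<^sup>2 * (2 * (1 + u) / u) ^ (2 * l) / real m"
      using u T \<open>0 < m\<close> by (simp add: field_simps flip: power_mult)
    also have "\<dots> \<le> T\<^sup>2 * (4 / \<epsilon>) ^ (2 * L) / real m"
    proof (intro divide_right_mono mult_left_mono)
      \<comment> \<open>In \<open>2 * (1 + u) / u = 2 / u + 2\<close> both summands are at most
        \<open>2 / \<epsilon>\<close>, by \<open>\<epsilon> \<le> u\<close> and
        \<open>\<epsilon> \<le> 1\<close>.\<close>
      have "\<epsilon> \<le> u" using assms by (simp add: u_def)
      then have "2 * (1 + u) / u \<le> 4 / \<epsilon>"
      proof -
        have "u * \<epsilon> \<le> u" using assms u by simp
        moreover have "2 * (1 + u) * \<epsilon> = 2 * \<epsilon> + 2 * (u * \<epsilon>)"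
          by (simp add: algebra_simps)
        ultimately have "2 * (1 + u) * \<epsilon> \<le> 4 * u" using \<open>\<epsilon> \<le> u\<close> by linarith
        then show ?thesis using u \<open>0 < \<epsilon>\<close> by (simp add: frac_le_eq divide_le_0_iff)
      qed
      then have "(2 * (1 + u) / u) ^ (2 * l) \<le> (4 / \<epsilon>) ^ (2 * l)"
        using u by (intro power_mono) auto
      also have "\<dots> \<le> (4 / \<epsilon>) ^ (2 * L)"
        using assms that by (intro power_increasing) (auto simp: field_simps)
      finally show "(2 * (1 + u) / u) ^ (2 * l) \<le> (4 / \<epsilon>) ^ (2 * L)" .
    qed auto
    finally show ?thesis .
  qed
  have "{xs. geo_estimator k n \<epsilon> m xs \<noteq> p ` {1..k}} \<subseteq> (\<Union>l\<le>L. bad l)"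
  proof
    fix xs assume "xs \<in> {xs. geo_estimator k n \<epsilon> m xs \<noteq> p ` {1..k}}"
    then have "\<not> consistent_with_sample k n \<epsilon> m xs p"
      using geo_estimator_eqI assms by blast
    then show "xs \<in> (\<Union>l\<le>L. bad l)"
      by (force simp: consistent_with_sample_def bad_def T_def L_def not_less)
  qed
  then have "measure_pmf.prob ?R {xs. geo_estimator k n \<epsilon> m xs \<noteq> p ` {1..k}}
      \<le> measure_pmf.prob ?R (\<Union>l\<le>L. bad l)"
    by (intro measure_pmf.finite_measure_mono) auto
  also have "\<dots> \<le> (\<Sum>l\<le>L. measure_pmf.prob ?R (bad l))"
    by (intro measure_pmf.finite_measure_subadditive_finite) auto
  also have "\<dots> \<le> (\<Sum>l\<le>L. T\<^sup>2 * (4 / \<epsilon>) ^ (2 * L) / real m)"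
    by (intro sum_mono bad) auto
  also have "\<dots> = (real L + 1) * (T\<^sup>2 * (4 / \<epsilon>) ^ (2 * L) / real m)"
    by simp
  also have "T\<^sup>2 * (4 / \<epsilon>) ^ (2 * L) = 4 * (real k)\<^sup>2 * (1936 ^ L * (1 / \<epsilon>) ^ (2 * L))"
  proof -
    have "(11 ^ L)\<^sup>2 * (4 / \<epsilon>) ^ (2 * L) = (11 ^ 2) ^ L * (4 ^ 2) ^ L * (1 / \<epsilon>) ^ (2 * L)"
    proof -
      have "(11 ^ L)\<^sup>2 = ((11 ^ 2) ^ L :: real)"
        by (metis power_even_eq power_mult)
      moreover have "(4 / \<epsilon>) ^ (2 * L) = (4 ^ 2) ^ L * (1 / \<epsilon>) ^ (2 * L)"
        by (simp only: power_mult power_divide power_one times_divide_eq_right mult_1_right)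
      ultimately show ?thesis by (simp only: mult.assoc)
    qed
    also have "(11 ^ 2) ^ L * (4 ^ 2) ^ L = (1936 :: real) ^ L"
      unfolding power_mult_distrib[symmetric] by simp
    finally have "(11 ^ L)\<^sup>2 * (4 / \<epsilon>) ^ (2 * L) = 1936 ^ L * (1 / \<epsilon>) ^ (2 * L)" .
    then show ?thesis by (simp add: T_def power_mult_distrib)
  qed
  finally show ?thesis
    by (simp only: times_divide_eq_right times_divide_eq_left mult_ac)
qed

text \<open>The right-hand power is \<open>exp (4 * sqrt n * ln n)\<close>, which outgrows every
  exponential in \<open>sqrt n\<close>; a quotient tending to 0 is bounded. At \<open>n = 0\<close>
  the denominator is 0, so clearing it requires \<open>1 \<le> n\<close>.\<close>

lemma exponential_le_sqrt_powr_sqrt: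
  obtains K :: real where "0 < K"
    "\<And>n. 1 \<le> n \<Longrightarrow> 4 * (4 * sqrt (real n) + 1) * 1936 powr (4 * sqrt (real n))
       \<le> K * sqrt (real n) powr (8 * sqrt (real n))"
proof -
  let ?f = "\<lambda>n::nat. 4 * (4 * sqrt (real n) + 1) * 1936 powr (4 * sqrt (real n)) /
    sqrt (real n) powr (8 * sqrt (real n))"
  have "?f \<longlonglongrightarrow> 0" by real_asymp
  then have "Bseq ?f" by (intro convergent_imp_Bseq convergentI)
  then obtain K where "0 < K" "\<And>n. norm (?f n) \<le> K" by (auto elim: BseqE)
  show ?thesis
  proof
    show "0 < K" by fact
    fix n :: nat assume "1 \<le> n"
    then have "0 < sqrt (real n) powr (8 * sqrt (real n))" by simp
    moreover have "?f n \<le> K" using \<open>norm (?f n) \<le> K\<close> by (simp add: abs_le_iff)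
    ultimately show "4 * (4 * sqrt (real n) + 1) * 1936 powr (4 * sqrt (real n))
       \<le> K * sqrt (real n) powr (8 * sqrt (real n))"
      by (simp add: pos_divide_le_eq)
  qed
qed

text \<open>The error bound is inversely proportional to \<open>m\<close>, so an absolute constant
  divided by \<open>\<delta>\<close> suffices.\<close>

lemma geo_estimator_sample_complexity:
  obtains K :: real where "0 < K"
    "\<And>(\<delta>::real) (\<epsilon>::real) (n::nat) (k::nat) (m::nat) p. 0 < \<delta> \<Longrightarrow> 0 < \<epsilon> \<Longrightarrow> \<epsilon> \<le> 1 \<Longrightarrow> 1 \<le> n \<Longrightarrow> 1 \<le> k \<Longrightarrow>
       K / \<delta> * real k ^ 2 * (sqrt (real n) / \<epsilon>) powr (8 * sqrt (real n)) \<le> real m \<Longrightarrow>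
       geo_params k n \<epsilon> p \<Longrightarrow>
       1 - \<delta> \<le> measure_pmf.prob (replicate_pmf m (geo_mixture k p))
                  {xs. geo_estimator k n \<epsilon> m xs = p ` {1..k}}"
proof -
  obtain K :: real where K: "0 < K"
    "\<And>n. 1 \<le> n \<Longrightarrow> 4 * (4 * sqrt (real n) + 1) * 1936 powr (4 * sqrt (real n))
       \<le> K * sqrt (real n) powr (8 * sqrt (real n))"
    using exponential_le_sqrt_powr_sqrt by blast
  show ?thesis
  proof
    show "0 < K" by fact
    fix \<delta> \<epsilon> :: real and n k m :: nat and p :: "nat \<Rightarrow> real"
    assume A: "0 < \<delta>" "0 < \<epsilon>" "\<epsilon> \<le> 1" "1 \<le> n" "1 \<le> k" "geo_params k n \<epsilon> p"
      and m: "K / \<delta> * real k ^ 2 * (sqrt (real n) / \<epsilon>) powr (8 * sqrt (real n)) \<le> real m"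
    let ?R = "replicate_pmf m (geo_mixture k p)"
    define s where "s = sqrt (real n)"
    define L where "L = 4 * nat \<lfloor>s\<rfloor>"
    have s: "1 \<le> s" using A by (simp add: s_def)
    then have L: "real L \<le> 4 * s" unfolding L_def by linarith
    have "0 < K / \<delta> * real k ^ 2 * (s / \<epsilon>) powr (8 * s)"
      using A K(1) s by (auto intro!: mult_pos_pos)
    then have "0 < m" using m unfolding s_def by linarith
    \<comment> \<open>Raising the integer exponents to \<open>4 * s\<close> and \<open>8 * s\<close>
      is monotone because the bases 1936 and \<open>1 / \<epsilon>\<close> are at least 1.\<close>
    have "4 * (real L + 1) * 1936 ^ L * (1 / \<epsilon>) ^ (2 * L)
        \<le> (4 * (4 * s + 1) * 1936 powr (4 * s)) * (1 / \<epsilon>) powr (8 * s)"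
    proof (rule mult_mono[OF mult_mono])
      show "4 * (real L + 1) \<le> 4 * (4 * s + 1)" using L by simp
      have "(1936::real) ^ L = 1936 powr real L" by (simp add: powr_realpow)
      also have "\<dots> \<le> 1936 powr (4 * s)" using L by (intro powr_mono) auto
      finally show "(1936::real) ^ L \<le> 1936 powr (4 * s)" .
      have "(1 / \<epsilon>) ^ (2 * L) = (1 / \<epsilon>) powr real (2 * L)"
        using A by (subst powr_realpow) auto
      also have "\<dots> \<le> (1 / \<epsilon>) powr (8 * s)" using L A by (intro powr_mono) auto
      finally show "(1 / \<epsilon>) ^ (2 * L) \<le> (1 / \<epsilon>) powr (8 * s)" .
    qed (use s A in auto)
    also have "\<dots> \<le> (K * s powr (8 * s)) * (1 / \<epsilon>) powr (8 * s)"
      using K(2)[OF \<open>1 \<le> n\<close>] unfolding s_def by (intro mult_right_mono) auto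
    also have "\<dots> = K * (s / \<epsilon>) powr (8 * s)"
      using s A by (simp add: powr_divide)
    finally have growth: "4 * (real L + 1) * 1936 ^ L * (1 / \<epsilon>) ^ (2 * L) \<le> K * (s / \<epsilon>) powr (8 * s)" .
    have "4 * (real L + 1) * 1936 ^ L * (real k)\<^sup>2 * (1 / \<epsilon>) ^ (2 * L)
        = (real k)\<^sup>2 * (4 * (real L + 1) * 1936 ^ L * (1 / \<epsilon>) ^ (2 * L))"
      by (simp only: mult_ac)
    also have "\<dots> \<le> (real k)\<^sup>2 * (K * (s / \<epsilon>) powr (8 * s))"
      by (intro mult_left_mono growth) auto
    also have "\<dots> = \<delta> * (K / \<delta> * real k ^ 2 * (s / \<epsilon>) powr (8 * s))"
      using A by simp
    also have "\<dots> \<le> \<delta> * real m"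
      using m A unfolding s_def by (intro mult_left_mono) auto
    finally have "4 * (real L + 1) * 1936 ^ L * (real k)\<^sup>2 * (1 / \<epsilon>) ^ (2 * L) / real m \<le> \<delta>"
      using \<open>0 < m\<close> by (simp add: pos_divide_le_eq)
    then have "measure_pmf.prob ?R {xs. geo_estimator k n \<epsilon> m xs \<noteq> p ` {1..k}} \<le> \<delta>"
      using prob_geo_estimator_error[of \<epsilon> n k m p] A \<open>0 < m\<close> unfolding L_def s_def by simp
    moreover have "measure_pmf.prob ?R {xs. geo_estimator k n \<epsilon> m xs = p ` {1..k}} =
        1 - measure_pmf.prob ?R {xs. geo_estimator k n \<epsilon> m xs \<noteq> p ` {1..k}}"
      using measure_pmf.prob_compl[of "{xs. geo_estimator k n \<epsilon> m xs \<noteq> p ` {1..k}}" ?R]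
      by (simp add: Compl_eq_Diff_UNIV[symmetric] Collect_neg_eq[symmetric])
    ultimately show "1 - \<delta> \<le> measure_pmf.prob ?R {xs. geo_estimator k n \<epsilon> m xs = p ` {1..k}}"
      by simp
  qed
qed

theorem theorem18:
  shows
    "(\<forall>(\<epsilon>::real) (n::nat) (k::nat) p q.
        0 < \<epsilon> \<and> \<epsilon> \<le> 1 \<and> 1 / \<epsilon> \<in> \<int> \<and> 1 \<le> n \<and> 1 \<le> k \<and>
        geo_params k n \<epsilon> p \<and> geo_params k n \<epsilon> q \<and>
        (\<forall>l::nat. real l \<le> 4 * sqrt (real n) \<longrightarrow>
           measure_pmf.expectation (geo_mixture k p) (\<lambda>x. real x ^ l) =
           measure_pmf.expectation (geo_mixture k q) (\<lambda>x. real x ^ l))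
        \<longrightarrow> p ` {1..k} = q ` {1..k})
     \<and>
     (\<exists>estimator :: nat \<Rightarrow> nat \<Rightarrow> real \<Rightarrow> nat \<Rightarrow> nat list \<Rightarrow> real set.
        \<forall>\<delta>::real. 0 < \<delta> \<and> \<delta> < 1 \<longrightarrow>
        (\<exists>C::real. 0 < C \<and>
          (\<forall>(\<epsilon>::real) (n::nat) (k::nat) (m::nat).
             0 < \<epsilon> \<and> \<epsilon> \<le> 1 \<and> 1 / \<epsilon> \<in> \<int> \<and> 1 \<le> n \<and> 1 \<le> k \<and>
             C * real k ^ 2 * (sqrt (real n) / \<epsilon>) powr (8 * sqrt (real n)) \<le> real m
             \<longrightarrow>
             (\<forall>p. geo_params k n \<epsilon> p \<longrightarrow>
                1 - \<delta> \<le> measure_pmf.prob (replicate_pmf m (geo_mixture k p))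
                  {xs. estimator k n \<epsilon> m xs = p ` {1..k}}))))"
proof (intro conjI)
  show "\<forall>(\<epsilon>::real) (n::nat) (k::nat) p q.
        0 < \<epsilon> \<and> \<epsilon> \<le> 1 \<and> 1 / \<epsilon> \<in> \<int> \<and> 1 \<le> n \<and> 1 \<le> k \<and>
        geo_params k n \<epsilon> p \<and> geo_params k n \<epsilon> q \<and>
        (\<forall>l::nat. real l \<le> 4 * sqrt (real n) \<longrightarrow>
           measure_pmf.expectation (geo_mixture k p) (\<lambda>x. real x ^ l) =
           measure_pmf.expectation (geo_mixture k q) (\<lambda>x. real x ^ l))
        \<longrightarrow> p ` {1..k} = q ` {1..k}"
    using moments_determine_geo_params by blast
next
  obtain K :: real where "0 < K" and
    K: "\<And>(\<delta>::real) (\<epsilon>::real) (n::nat) (k::nat) (m::nat) p. 0 < \<delta> \<Longrightarrow> 0 < \<epsilon> \<Longrightarrow> \<epsilon> \<le> 1 \<Longrightarrow> 1 \<le> n \<Longrightarrow> 1 \<le> k \<Longrightarrow>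
       K / \<delta> * real k ^ 2 * (sqrt (real n) / \<epsilon>) powr (8 * sqrt (real n)) \<le> real m \<Longrightarrow>
       geo_params k n \<epsilon> p \<Longrightarrow>
       1 - \<delta> \<le> measure_pmf.prob (replicate_pmf m (geo_mixture k p))
                  {xs. geo_estimator k n \<epsilon> m xs = p ` {1..k}}"
    using geo_estimator_sample_complexity by blast
  show "\<exists>estimator :: nat \<Rightarrow> nat \<Rightarrow> real \<Rightarrow> nat \<Rightarrow> nat list \<Rightarrow> real set.
        \<forall>\<delta>::real. 0 < \<delta> \<and> \<delta> < 1 \<longrightarrow>
        (\<exists>C::real. 0 < C \<and>
          (\<forall>(\<epsilon>::real) (n::nat) (k::nat) (m::nat).
             0 < \<epsilon> \<and> \<epsilon> \<le> 1 \<and> 1 / \<epsilon> \<in> \<int> \<and> 1 \<le> n \<and> 1 \<le> k \<and>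
             C * real k ^ 2 * (sqrt (real n) / \<epsilon>) powr (8 * sqrt (real n)) \<le> real m
             \<longrightarrow>
             (\<forall>p. geo_params k n \<epsilon> p \<longrightarrow>
                1 - \<delta> \<le> measure_pmf.prob (replicate_pmf m (geo_mixture k p))
                  {xs. estimator k n \<epsilon> m xs = p ` {1..k}})))"
  \<comment> \<open>One estimator serves every \<open>\<delta>\<close>; only the constant
    \<open>K / \<delta>\<close> varies.\<close>
  proof (intro exI[of _ geo_estimator] allI impI)
    fix \<delta> :: real assume \<delta>: "0 < \<delta> \<and> \<delta> < 1"
    show "\<exists>C::real. 0 < C \<and>
          (\<forall>(\<epsilon>::real) (n::nat) (k::nat) (m::nat).
             0 < \<epsilon> \<and> \<epsilon> \<le> 1 \<and> 1 / \<epsilon> \<in> \<int> \<and> 1 \<le> n \<and> 1 \<le> k \<and>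
             C * real k ^ 2 * (sqrt (real n) / \<epsilon>) powr (8 * sqrt (real n)) \<le> real m
             \<longrightarrow>
             (\<forall>p. geo_params k n \<epsilon> p \<longrightarrow>
                1 - \<delta> \<le> measure_pmf.prob (replicate_pmf m (geo_mixture k p))
                  {xs. geo_estimator k n \<epsilon> m xs = p ` {1..k}}))"
    proof (intro exI[of _ "K / \<delta>"] conjI allI impI; (elim conjE)?)
      show "0 < K / \<delta>" using \<delta> \<open>0 < K\<close> by simp
    qed (rule K; use \<delta> in simp)
  qed
qed

end
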